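(* Let $p$ be a prime and let $N$ be a nontrivial finite abelian $p$-group of rank $r$ and exponent $p^d$. If $\mathrm{Hol}(N)$ contains an element of order $p^k$, then $k<\lceil \log_p(r+1)\rceil+d$.
   Context: The rank $r$ of $N$ is the number of factors in a decomposition of $N$ as a direct product of nontrivial cyclic groups of $p$-power order (equivalently the minimal number of generators). $\mathrm{Hol}(N)=N\rtimes \mathrm{Aut}(N)$ is the holomorph of $N$. *)

theory Defs
  imports "HOL-Algebra.Algebra" Complex_Main
begin

definition is_p_group :: "nat \<Rightarrow> ('a, 'b) monoid_scheme \<Rightarrow> bool"
  where "is_p_group p G \<longleftrightarrow> group G \<and> (\<forall>x\<in>carrier G. \<exists>n. group.ord G x = p ^ n)"

text \<open>Only meaningful if such an \<open>n\<close> exists, as it does for finite groups.\<close>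

definition group_exponent :: "('a, 'b) monoid_scheme \<Rightarrow> nat"
  where "group_exponent G = (LEAST n. 0 < n \<and> (\<forall>x\<in>carrier G. x [^]\<^bsub>G\<^esub> n = \<one>\<^bsub>G\<^esub>))"

text \<open>A finite abelian \<open>p\<close>-group has rank \<open>r\<close> if it decomposes as a direct product of \<open>r\<close>
  nontrivial cyclic groups of \<open>p\<close>-power order. This is a relation, so that no choice among
  decompositions is involved; for prime \<open>p\<close> the number \<open>r\<close> is determined by the group.\<close>

definition has_rank :: "nat \<Rightarrow> ('a, 'b) monoid_scheme \<Rightarrow> nat \<Rightarrow> bool"
  where "has_rank p G r \<longleftrightarrow>
    (\<exists>e :: nat \<Rightarrow> nat. (\<forall>i<r. 0 < e i) \<and>
       G \<cong> product_group {..<r} (\<lambda>i. integer_mod_group (p ^ e i)))"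

definition semidirect_product ::
    "('a, 'c) monoid_scheme \<Rightarrow> ('b, 'd) monoid_scheme \<Rightarrow> ('b \<Rightarrow> 'a \<Rightarrow> 'a) \<Rightarrow> ('a \<times> 'b) monoid"
  where "semidirect_product N H \<phi> =
    \<lparr>carrier = carrier N \<times> carrier H,
     monoid.mult = (\<lambda>(x, g) (y, h). (x \<otimes>\<^bsub>N\<^esub> \<phi> g y, g \<otimes>\<^bsub>H\<^esub> h)),
     one = (\<one>\<^bsub>N\<^esub>, \<one>\<^bsub>H\<^esub>)\<rparr>"

definition holomorph :: "('a, 'b) monoid_scheme \<Rightarrow> ('a \<times> ('a \<Rightarrow> 'a)) monoid"
  where "holomorph N = semidirect_product N (AutoGroup N) (\<lambda>\<alpha>. \<alpha>)"

lemma group_semidirect_product: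
  assumes "group N" "group H" and \<phi>: "\<phi> \<in> hom H (AutoGroup N)"
  shows "group (semidirect_product N H \<phi>)"
proof -
  interpret N: group N by fact
  interpret H: group H by fact
  have aut: "\<phi> h \<in> auto N" if "h \<in> carrier H" for h
    using hom_in_carrier[OF \<phi> that] by (simp add: AutoGroup_def)
  have cl: "\<phi> h x \<in> carrier N" if "h \<in> carrier H" "x \<in> carrier N" for h x
    using aut[OF that(1)] that(2) by (auto simp: auto_def hom_def)
  have mul: "\<phi> h (x \<otimes>\<^bsub>N\<^esub> y) = \<phi> h x \<otimes>\<^bsub>N\<^esub> \<phi> h y"
    if "h \<in> carrier H" "x \<in> carrier N" "y \<in> carrier N" for h x y
    using aut[OF that(1)] that(2,3) by (auto simp: auto_def hom_def)
  have comp: "\<phi> (g \<otimes>\<^bsub>H\<^esub> h) x = \<phi> g (\<phi> h x)"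
    if "g \<in> carrier H" "h \<in> carrier H" "x \<in> carrier N" for g h x
  proof -
    have "\<phi> g \<in> Bij (carrier N)" "\<phi> h \<in> Bij (carrier N)"
      using aut that by (auto simp: auto_def)
    then have "\<phi> (g \<otimes>\<^bsub>H\<^esub> h) = compose (carrier N) (\<phi> g) (\<phi> h)"
      using hom_mult[OF \<phi> that(1,2)] by (simp add: AutoGroup_def BijGroup_def)
    then show ?thesis using that by (simp add: compose_def)
  qed
  have one: "\<phi> \<one>\<^bsub>H\<^esub> x = x" if "x \<in> carrier N" for x
    using hom_one[OF \<phi> assms(2) N.AutoGroup] that by (simp add: AutoGroup_def BijGroup_def)
  show ?thesis
  proof (rule groupI)
    fix z assume "z \<in> carrier (semidirect_product N H \<phi>)"
    then obtain x g where z: "z = (x, g)" "x \<in> carrier N" "g \<in> carrier H"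
      by (auto simp: semidirect_product_def)
    let ?i = "(\<phi> (inv\<^bsub>H\<^esub> g) (inv\<^bsub>N\<^esub> x), inv\<^bsub>H\<^esub> g)"
    have "\<phi> (inv\<^bsub>H\<^esub> g) (inv\<^bsub>N\<^esub> x) \<otimes>\<^bsub>N\<^esub> \<phi> (inv\<^bsub>H\<^esub> g) x = \<one>\<^bsub>N\<^esub>"
    proof -
      have "\<phi> (inv\<^bsub>H\<^esub> g) \<one>\<^bsub>N\<^esub> \<otimes>\<^bsub>N\<^esub> \<phi> (inv\<^bsub>H\<^esub> g) \<one>\<^bsub>N\<^esub> = \<phi> (inv\<^bsub>H\<^esub> g) \<one>\<^bsub>N\<^esub>"
        using mul[of "inv\<^bsub>H\<^esub> g" "\<one>\<^bsub>N\<^esub>" "\<one>\<^bsub>N\<^esub>"] z by simp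
      then have "\<phi> (inv\<^bsub>H\<^esub> g) \<one>\<^bsub>N\<^esub> = \<one>\<^bsub>N\<^esub>"
        using N.l_cancel_one cl z by (metis H.inv_closed N.one_closed)
      then show ?thesis
        using mul[of "inv\<^bsub>H\<^esub> g" "inv\<^bsub>N\<^esub> x" x] z by simp
    qed
    then show "\<exists>y\<in>carrier (semidirect_product N H \<phi>).
        y \<otimes>\<^bsub>semidirect_product N H \<phi>\<^esub> z = \<one>\<^bsub>semidirect_product N H \<phi>\<^esub>"
      using z cl by (intro bexI[of _ ?i]) (auto simp: semidirect_product_def)
  qed (auto simp: semidirect_product_def cl mul comp one N.m_assoc H.m_assoc)
qed

lemma group_holomorph:
  assumes "group N"
  shows "group (holomorph N)"
  unfolding holomorph_def
  by (rule group_semidirect_product) (auto simp: assms group.AutoGroup hom_def)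

end

theory Submission
  imports Defs "HOL-Computational_Algebra.Polynomial"
begin

text \<open>The power \<open>(x, \<alpha>) ^ n\<close> in the holomorph is \<open>(S\<^sub>n x, \<alpha> ^ n)\<close>, where
  \<open>S\<^sub>n = 1 + \<alpha> + \<dots> + \<alpha> ^ (n - 1)\<close>. If \<open>\<alpha>\<close> has \<open>p\<close>-power order, then
  \<open>\<alpha> - 1\<close> is nilpotent on the \<open>r\<close>-dimensional space \<open>N / pN\<close>, so \<open>(\<alpha> - 1) ^ r\<close> maps
  \<open>N\<close> into \<open>pN\<close>. Modulo \<open>p\<close> one has \<open>S\<^sub>q = (\<alpha> - 1) ^ (q - 1)\<close> for \<open>q = p ^ m\<close>; hence
  \<open>S\<^sub>q\<close> maps \<open>N\<close> into \<open>pN\<close> once \<open>p ^ m > r\<close>. Every further factor \<open>p\<close> in the index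
  gains a factor \<open>p\<close> in the image, since \<open>S\<^bsub>pq\<^esub> = (1 + \<alpha> ^ q + \<dots> + \<alpha> ^ (q (p - 1))) S\<^sub>q\<close>
  and the first factor is congruent to \<open>(\<alpha> ^ q - 1) ^ (p - 1)\<close>. So \<open>S\<^sub>n\<close> kills \<open>N\<close>
  for \<open>n = p ^ (m + d - 1)\<close>, and so does \<open>\<alpha> ^ n - 1 = (\<alpha> - 1) S\<^sub>n\<close>.\<close>

section \<open>Congruences modulo a prime for geometric sums\<close>

text \<open>Both sides are the polynomial \<open>((1 + y) ^ n - 1) / y\<close>. As \<open>y\<close>
  need not be cancellable, induction with Pascal's rule replaces the division.\<close>

lemma geometric_sum_shift:
  fixes y :: "'a::comm_ring_1"
  shows "(\<Sum>i<n. (1 + y) ^ i) = (\<Sum>i<n. of_nat (n choose Suc i) * y ^ i)"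
proof (induction n)
  case (Suc n)
  have "(of_nat (n choose Suc n) :: 'a) = 0"
    by (subst binomial_eq_0) auto
  then have "(\<Sum>i<Suc n. (1 + y) ^ i) = (\<Sum>i<Suc n. of_nat (n choose Suc i) * y ^ i) + (1 + y) ^ n"
    using Suc by (simp only: sum.lessThan_Suc mult_zero_left add_0_right)
  also have "(1 + y) ^ n = (\<Sum>i<Suc n. of_nat (n choose i) * y ^ i)"
    using binomial_ring[of y 1 n] by (simp add: lessThan_Suc_atMost add.commute)
  finally show ?case
    by (simp only: binomial_Suc_Suc of_nat_add distrib_right sum.distrib add.commute)
qed simp

text \<open>Since \<open>p ^ m\<close> divides \<open>i * (p ^ m choose i)\<close>, a binomial
  coefficient prime to \<open>p\<close> would force \<open>p ^ m\<close> to divide the smaller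
  positive number \<open>i\<close>.\<close>

lemma prime_dvd_prime_power_choose:
  fixes p :: nat
  assumes "Factorial_Ring.prime p" "0 < i" "i < p ^ m"
  shows "p dvd (p ^ m choose i)"
proof (rule ccontr)
  assume "\<not> p dvd (p ^ m choose i)"
  then have "coprime (p ^ m) (p ^ m choose i)"
    using assms(1) by (simp add: prime_imp_coprime)
  moreover have "p ^ m dvd i * (p ^ m choose i)"
    using times_binomial_minus1_eq[of i "p ^ m"] assms(2) by simp
  ultimately have "p ^ m dvd i"
    using coprime_dvd_mult_left_iff by blast
  then show False
    using assms(2,3) by (auto dest: dvd_imp_le)
qed

lemma of_nat_dvd_of_natI: "m dvd n \<Longrightarrow> (of_nat m :: 'a::comm_semiring_1) dvd of_nat n"
  by (elim dvdE) simp

text \<open>Expanded in powers of \<open>x - 1\<close>, the sum has top coefficient 1, and its other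
  coefficients are inner binomial coefficients of \<open>p ^ m\<close>.\<close>

lemma prime_dvd_geometric_sum_diff:
  fixes x :: "'a::comm_ring_1"
  assumes "Factorial_Ring.prime p"
  shows "of_nat p dvd (\<Sum>i<p ^ m. x ^ i) - (x - 1) ^ (p ^ m - 1)"
proof -
  obtain q where q: "p ^ m = Suc q"
    using assms by (metis not0_implies_Suc power_not_zero not_prime_0)
  have "(\<Sum>i<p ^ m. x ^ i) - (x - 1) ^ (p ^ m - 1) = (\<Sum>i<q. of_nat (Suc q choose Suc i) * (x - 1) ^ i)"
    using geometric_sum_shift[of "x - 1" "Suc q"] by (simp add: q del: binomial_Suc_Suc)
  moreover have "of_nat p dvd (of_nat (Suc q choose Suc i) :: 'a)" if "i < q" for i
    using prime_dvd_prime_power_choose[OF assms, of "Suc i" m] that q by (metis Suc_mono of_nat_dvd_of_natI zero_less_Suc)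
  ultimately show ?thesis
    by (auto intro!: dvd_sum)
qed

lemma prime_dvd_power_minus_one_diff:
  fixes x :: "'a::comm_ring_1"
  assumes "Factorial_Ring.prime p"
  shows "of_nat p dvd (x ^ p ^ m - 1) - (x - 1) ^ p ^ m"
proof -
  have "(x - 1) ^ p ^ m = (x - 1) * (x - 1) ^ (p ^ m - 1)"
    using prime_gt_0_nat[OF assms] by (metis power_eq_if neq0_conv power_not_zero)
  then have "(x ^ p ^ m - 1) - (x - 1) ^ p ^ m
      = (x - 1) * ((\<Sum>i<p ^ m. x ^ i) - (x - 1) ^ (p ^ m - 1))"
    by (simp add: power_diff_1_eq right_diff_distrib)
  then show ?thesis
    using prime_dvd_geometric_sum_diff[OF assms, of x m] by simp
qed

text \<open>Each exponent below \<open>m * n\<close> is uniquely \<open>m * a + b\<close> with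
  \<open>a < n\<close> and \<open>b < m\<close>.\<close>

lemma geometric_sum_mult:
  fixes x :: "'a::comm_ring_1"
  shows "(\<Sum>i<m * n. x ^ i) = (\<Sum>i<n. (x ^ m) ^ i) * (\<Sum>i<m. x ^ i)"
proof (induction n)
  case (Suc n)
  have split_sum: "(\<Sum>i<a + b. x ^ i) = (\<Sum>i<a. x ^ i) + (\<Sum>i<b. x ^ (a + i))" for a b
    by (induction b) (auto simp: add_ac)
  have "(\<Sum>i<m * Suc n. x ^ i) = (\<Sum>i<m * n. x ^ i) + (\<Sum>i<m. x ^ (m * n + i))"
    using split_sum[of "m * n" m] by (simp add: add.commute)
  then show ?case
    by (simp add: Suc power_add power_mult distrib_right flip: sum_distrib_left)
qed simp

section \<open>Abelian groups as modules over integer polynomials\<close>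

locale endo_group = comm_group G for G (structure) +
  fixes \<alpha>
  assumes endo: "\<alpha> \<in> hom G G"
begin

text \<open>The action of \<open>\<int>[X]\<close> on the group in which \<open>X\<close> acts as \<open>\<alpha>\<close>. Working with integer
  polynomials makes all operators in \<open>\<alpha>\<close> commute and reduces congruences between them to
  divisibility by \<open>p\<close> in \<open>\<int>[X]\<close>.\<close>

definition act :: "int poly \<Rightarrow> 'a \<Rightarrow> 'a"
  where "act P x = fold_coeffs (\<lambda>a y. x [^] a \<otimes> \<alpha> y) P \<one>"

lemma endo_closed [simp]: "x \<in> carrier G \<Longrightarrow> \<alpha> x \<in> carrier G"
  using endo by (auto simp: hom_def)

lemma endo_mult: "x \<in> carrier G \<Longrightarrow> y \<in> carrier G \<Longrightarrow> \<alpha> (x \<otimes> y) = \<alpha> x \<otimes> \<alpha> y"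
  using endo by (auto simp: hom_def)

lemma endo_one [simp]: "\<alpha> \<one> = \<one>"
  using endo hom_one is_group by blast

lemma act_0 [simp]: "act 0 x = \<one>"
  by (simp add: act_def)

lemma act_pCons [simp]:
  assumes "x \<in> carrier G"
  shows "act (pCons a P) x = x [^] a \<otimes> \<alpha> (act P x)"
  \<comment> \<open>The polynomial \<open>pCons 0 0\<close> is \<open>0\<close>, whose coefficient
    list is empty, so the fold takes no step there; both sides are still
    \<open>\<one>\<close>.\<close>
  using assms by (cases "P = 0 \<and> a = 0") (auto simp: act_def)

lemma act_closed [simp]: "x \<in> carrier G \<Longrightarrow> act P x \<in> carrier G"
  by (induction P) auto

lemma act_add:
  assumes "x \<in> carrier G"
  shows "act (P + Q) x = act P x \<otimes> act Q x"
  using assms by (induction P Q rule: poly_induct2) (auto simp: int_pow_mult endo_mult m_ac)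

lemma act_mult_arg:
  assumes "x \<in> carrier G" "y \<in> carrier G"
  shows "act P (x \<otimes> y) = act P x \<otimes> act P y"
  using assms by (induction P) (auto simp: int_pow_mult_distrib m_comm endo_mult m_ac)

lemma endo_int_pow:
  assumes "x \<in> carrier G"
  shows "\<alpha> (x [^] (a :: int)) = \<alpha> x [^] a"
  using assms endo hom_int_pow is_group by metis

lemma act_smult:
  assumes "x \<in> carrier G"
  shows "act (smult a P) x = act P x [^] a"
  using assms
  by (induction P) (auto simp: int_pow_mult_distrib m_comm endo_int_pow int_pow_pow mult.commute)

lemma act_mult:
  assumes "x \<in> carrier G"
  shows "act (P * Q) x = act P (act Q x)"
  using assms by (induction P) (auto simp: act_add act_smult)

lemma act_1 [simp]: "x \<in> carrier G \<Longrightarrow> act 1 x = x"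
  by (simp add: one_pCons)

lemma act_one_arg [simp]: "act P \<one> = \<one>"
  by (induction P) auto

lemma act_of_nat: "x \<in> carrier G \<Longrightarrow> act (of_nat n) x = x [^] n"
  by (simp add: of_nat_poly int_pow_int)

text \<open>Raising to the \<open>n\<close>-th power is the action of the constant \<open>n\<close>,
  and polynomials commute.\<close>

lemma act_nat_pow: "x \<in> carrier G \<Longrightarrow> act P (x [^] (n :: nat)) = act P x [^] n"
  by (metis act_closed act_mult act_of_nat mult.commute)

lemma endo_funpow_closed [simp]: "x \<in> carrier G \<Longrightarrow> (\<alpha> ^^ n) x \<in> carrier G"
  by (induction n) auto

lemma act_monom: "x \<in> carrier G \<Longrightarrow> act ([:0, 1:] ^ n) x = (\<alpha> ^^ n) x"
  by (induction n) (auto simp: act_mult)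

section \<open>Operators that vanish modulo n\<close>

text \<open>Written additively, P maps N into nN; equivalently, P acts as zero on N / nN.\<close>

definition maps_into_powers :: "nat \<Rightarrow> int poly \<Rightarrow> bool"
  where "maps_into_powers n P \<longleftrightarrow> act P ` carrier G \<subseteq> (\<lambda>y. y [^] n) ` carrier G"

lemma maps_into_powersE:
  assumes "maps_into_powers n P" "x \<in> carrier G"
  obtains y where "y \<in> carrier G" "act P x = y [^] n"
  using assms by (auto simp: maps_into_powers_def)

lemma maps_into_powersI:
  assumes "\<And>x. x \<in> carrier G \<Longrightarrow> \<exists>y\<in>carrier G. act P x = y [^] n"
  shows "maps_into_powers n P"
  using assms by (auto simp: maps_into_powers_def image_iff)

lemma maps_into_powers_add:
  assumes "maps_into_powers n P" "maps_into_powers n Q"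
  shows "maps_into_powers n (P + Q)"
proof (rule maps_into_powersI)
  fix x assume x: "x \<in> carrier G"
  obtain y z where "y \<in> carrier G" "act P x = y [^] n" "z \<in> carrier G" "act Q x = z [^] n"
    using assms x by (meson maps_into_powersE)
  then show "\<exists>y\<in>carrier G. act (P + Q) x = y [^] n"
    using x by (intro bexI[of _ "y \<otimes> z"]) (auto simp: act_add pow_mult_distrib m_comm)
qed

text \<open>The action of \<open>P\<close> commutes with taking \<open>n\<close>-th powers, so the
  two gains multiply.\<close>

lemma maps_into_powers_mult:
  assumes "maps_into_powers m P" "maps_into_powers n Q"
  shows "maps_into_powers (m * n) (P * Q)"
proof (rule maps_into_powersI)
  fix x assume x: "x \<in> carrier G"
  obtain y where y: "y \<in> carrier G" "act Q x = y [^] n"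
    using assms x by (meson maps_into_powersE)
  obtain z where "z \<in> carrier G" "act P y = z [^] m"
    using assms y by (meson maps_into_powersE)
  then show "\<exists>y\<in>carrier G. act (P * Q) x = y [^] (m * n)"
    using x y by (intro bexI[of _ z]) (auto simp: act_mult act_nat_pow nat_pow_pow)
qed

lemma maps_into_powers_1: "maps_into_powers 1 P"
  by (rule maps_into_powersI) auto

lemma maps_into_powers_mult_left: "maps_into_powers n Q \<Longrightarrow> maps_into_powers n (P * Q)"
  using maps_into_powers_mult[OF maps_into_powers_1, of n Q P] by simp

lemma maps_into_powers_of_nat: "maps_into_powers n (of_nat n)"
  by (rule maps_into_powersI) (auto simp: act_of_nat)

text \<open>Multiples of \<open>n\<close> send everything to \<open>n\<close>-th powers, so only the
  class of the polynomial modulo \<open>n\<close> matters.\<close>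

lemma maps_into_powers_cong:
  assumes "of_nat n dvd P - Q"
  shows "maps_into_powers n P \<longleftrightarrow> maps_into_powers n Q"
proof -
  have "maps_into_powers n P" if d: "of_nat n dvd P - Q" and Q: "maps_into_powers n Q" for P Q
  proof -
    obtain R where "P - Q = of_nat n * R"
      using d by (auto elim: dvdE)
    then have "P = R * of_nat n + Q"
      by (simp add: algebra_simps)
    then show ?thesis
      using Q by (simp add: maps_into_powers_add maps_into_powers_mult_left maps_into_powers_of_nat)
  qed
  from this[of P Q] this[of Q P] show ?thesis
    using assms by (metis dvd_minus_iff minus_diff_eq)
qed

section \<open>Nilpotency modulo p and its effect on geometric sums\<close>

text \<open>With X for \<open>[:0, 1:]\<close>, the polynomial \<open>X ^ p ^ k - 1\<close> acts
  trivially and is congruent to \<open>(X - 1) ^ p ^ k\<close> modulo \<open>p\<close>.\<close>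

lemma maps_into_powers_minus_one_power:
  assumes p: "Factorial_Ring.prime p"
    and tors: "\<And>x. x \<in> carrier G \<Longrightarrow> (\<alpha> ^^ p ^ k) x = x"
  shows "maps_into_powers p (([:0, 1:] - 1) ^ p ^ k)"
proof -
  have "act ([:0, 1:] ^ p ^ k - 1) x = \<one>" if "x \<in> carrier G" for x
  proof -
    have "act (([:0, 1:] ^ p ^ k - 1) + 1) x = act ([:0, 1:] ^ p ^ k - 1) x \<otimes> act 1 x"
      using act_add that by blast
    then show ?thesis
      using that tors[OF that] by (simp add: act_monom)
  qed
  then have "maps_into_powers p ([:0, 1:] ^ p ^ k - 1)"
    by (intro maps_into_powersI) (auto intro!: bexI[of _ \<one>])
  then show ?thesis
    using maps_into_powers_cong[OF prime_dvd_power_minus_one_diff[OF p]] by blast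
qed

lemma maps_into_powers_geometric_sum:
  assumes p: "Factorial_Ring.prime p"
    and r: "maps_into_powers p (([:0, 1:] - 1) ^ r)" and m: "r < p ^ m"
  shows "maps_into_powers (p ^ Suc j) (\<Sum>i<p ^ (m + j). [:0, 1:] ^ i)"
proof (induction j)
  case 0
  have "([:0, 1:] - 1 :: int poly) ^ (p ^ m - 1) = ([:0, 1:] - 1) ^ (p ^ m - 1 - r) * ([:0, 1:] - 1) ^ r"
    using m by (simp flip: power_add)
  then have "maps_into_powers p (([:0, 1:] - 1) ^ (p ^ m - 1))"
    using r by (simp add: maps_into_powers_mult_left)
  then show ?case
    using maps_into_powers_cong[OF prime_dvd_geometric_sum_diff[OF p]] by simp
next
  case (Suc j)
  let ?S = "\<Sum>i<p ^ (m + j). [:0, 1:] ^ i :: int poly" and ?x = "[:0, 1:] ^ p ^ (m + j) :: int poly"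
  obtain q where q: "p - 1 = Suc q"
    using prime_gt_1_nat[OF p] by (metis Suc_diff_Suc zero_less_diff gr0_implies_Suc)
  have *: "maps_into_powers p ?S"
  proof (rule maps_into_powersI)
    fix x assume x: "x \<in> carrier G"
    with Suc obtain y where "y \<in> carrier G" "act ?S x = y [^] (p ^ Suc j)"
      using maps_into_powersE by blast
    then show "\<exists>y\<in>carrier G. act ?S x = y [^] p"
      by (intro bexI[of _ "y [^] (p ^ j)"]) (auto simp: nat_pow_pow mult.commute)
  qed
  \<comment> \<open>As \<open>p - 1\<close> is positive, one factor \<open>?x - 1\<close> can be
    split off, and it is \<open>[:0, 1:] - 1\<close> times \<open>?S\<close>.\<close>
  have "(?x - 1) ^ (p - 1) = ((?x - 1) ^ q * ([:0, 1:] - 1)) * ?S"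
    by (simp only: q power_Suc power_diff_1_eq[of "[:0, 1:] :: int poly" "p ^ (m + j)"] mult_ac)
  then have "maps_into_powers p ((?x - 1) ^ (p - 1))"
    using * maps_into_powers_mult_left by metis
  then have "maps_into_powers p (\<Sum>i<p. ?x ^ i)"
    using maps_into_powers_cong[OF prime_dvd_geometric_sum_diff[OF p, of ?x 1]] by simp
  from maps_into_powers_mult[OF this Suc] show ?case
    using geometric_sum_mult[of "[:0, 1:] :: int poly" "p ^ (m + j)" p] by (simp add: mult_ac)
qed

text \<open>The subgroups \<open>W i = P ^ i N + pN\<close> descend to \<open>pN\<close>, strictly until they reach it, and
  each strict step divides the order by at least \<open>p\<close>; there are at most \<open>r\<close> such steps.\<close>

lemma maps_into_powers_power:
  assumes p: "Factorial_Ring.prime p"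
    and fin: "finite (carrier G)" and s: "card (carrier G) = p ^ s"
    and r: "card (carrier G) \<le> p ^ r * card ((\<lambda>y. y [^] p) ` carrier G)"
    and nilp: "maps_into_powers p (P ^ n)"
  shows "maps_into_powers p (P ^ r)"
proof (rule ccontr)
  define W where "W i = (\<lambda>(u, v). act (P ^ i) u \<otimes> v [^] p) ` (carrier G \<times> carrier G)" for i
  have WI: "act (P ^ i) u \<otimes> v [^] p \<in> W i" if "u \<in> carrier G" "v \<in> carrier G" for i u v
    using that by (auto simp: W_def)
  have act_W: "act (P ^ i) u \<in> W i" if "u \<in> carrier G" for i u
    using WI[of u \<one> i] that by simp
  have subgroup: "subgroup (W i) G" for i
  proof -
    have "(\<lambda>(u, v). act (P ^ i) u \<otimes> v [^] p) \<in> hom (G \<times>\<times> G) G"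
      by (auto simp: hom_def act_mult_arg pow_mult_distrib m_comm m_ac)
    then interpret f: group_hom "G \<times>\<times> G" G "\<lambda>(u, v). act (P ^ i) u \<otimes> v [^] p"
      by (simp add: group_hom_def group_hom_axioms_def DirProd_group)
    show ?thesis
      using f.img_is_subgroup by (simp add: W_def)
  qed
  have finW: "finite (W i)" for i
    using finite_subset[OF subgroup.subset[OF subgroup] fin] .
  have cardW: "\<exists>a. card (W i) = p ^ a" for i
  proof -
    have "card (W i) dvd p ^ s"
      using lagrange[OF subgroup[of i]] s by (intro dvdI[of _ _ "card (rcosets W i)"]) (simp add: Coset.order_def mult.commute)
    then show ?thesis
      using p divides_primepow_nat by blast
  qed
  have anti: "W (Suc i) \<subseteq> W i" for i
  proof
    fix w assume "w \<in> W (Suc i)"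
    then obtain u v where w: "u \<in> carrier G" "v \<in> carrier G" "w = act (P ^ Suc i) u \<otimes> v [^] p"
      by (auto simp: W_def)
    then have "w = act (P ^ i) (act P u) \<otimes> v [^] p"
      by (simp only: power_Suc2 act_mult)
    then show "w \<in> W i"
      using w WI by simp
  qed
  have powers: "(\<lambda>y. y [^] p) ` carrier G \<subseteq> W i" for i
    using WI[of \<one>] by auto
  have W_iff: "maps_into_powers p (P ^ i) \<longleftrightarrow> W i = (\<lambda>y. y [^] p) ` carrier G" for i
  proof
    assume "maps_into_powers p (P ^ i)"
    then have "W i \<subseteq> (\<lambda>y. y [^] p) ` carrier G"
    proof -
      have "act (P ^ i) u \<otimes> v [^] p \<in> (\<lambda>y. y [^] p) ` carrier G"
        if uv: "u \<in> carrier G" "v \<in> carrier G" for u v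
      proof -
        obtain y where "y \<in> carrier G" "act (P ^ i) u = y [^] p"
          using \<open>maps_into_powers p (P ^ i)\<close> uv maps_into_powersE by blast
        then show ?thesis
          using uv by (auto simp: image_iff pow_mult_distrib m_comm intro!: bexI[of _ "y \<otimes> v"])
      qed
      then show ?thesis
        by (auto simp: W_def)
    qed
    then show "W i = (\<lambda>y. y [^] p) ` carrier G"
      using powers by blast
  next
    assume eq: "W i = (\<lambda>y. y [^] p) ` carrier G"
    show "maps_into_powers p (P ^ i)"
      unfolding maps_into_powers_def using eq act_W by blast
  qed
  \<comment> \<open>Applying \<open>P\<close> propagates one equality in the chain to all later
    ones. Since the chain ends at the \<open>p\<close>-th powers by nilpotency, it is already there
    at \<open>i\<close>.\<close>
  have stable: "maps_into_powers p (P ^ i)" if eq: "W i \<subseteq> W (Suc i)" for i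
  proof -
    have "W j \<subseteq> W (Suc j)" if "i \<le> j" for j
      using that
    proof (induction j rule: dec_induct)
      case base
      then show ?case using eq .
    next
      case (step j)
      show ?case
      proof
        fix w assume "w \<in> W (Suc j)"
        then obtain u v where w: "u \<in> carrier G" "v \<in> carrier G" "w = act (P ^ Suc j) u \<otimes> v [^] p"
          by (auto simp: W_def)
        have "act (P ^ j) u \<in> W (Suc j)"
          using w step act_W by blast
        then obtain u' v' where w': "u' \<in> carrier G" "v' \<in> carrier G"
            "act (P ^ j) u = act (P ^ Suc j) u' \<otimes> v' [^] p"
          by (auto simp: W_def)
        have "w = act P (act (P ^ j) u) \<otimes> v [^] p"
          using w by (simp add: act_mult)
        also have "\<dots> = act (P ^ Suc (Suc j)) u' \<otimes> (act P v' \<otimes> v) [^] p"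
          using w w' by (simp add: act_mult act_mult_arg act_nat_pow pow_mult_distrib m_comm m_assoc)
        finally show "w \<in> W (Suc (Suc j))"
          using w w' WI by (simp del: power_Suc)
      qed
    qed
    then have "W i \<subseteq> W (i + t)" for t
      by (intro lift_Suc_mono_le[of "\<lambda>t. W (i + t)" 0 t, simplified]) simp
    moreover have "W (n + i) = (\<lambda>y. y [^] p) ` carrier G"
      using nilp maps_into_powers_mult_left[of p "P ^ n" "P ^ i"]
      by (simp add: W_iff[symmetric] power_add mult.commute)
    ultimately show ?thesis
      using powers[of i] unfolding W_iff by (metis add.commute subset_antisym)
  qed
  have shrink: "card (W i) * p ^ i \<le> card (carrier G)" if "\<not> maps_into_powers p (P ^ i)" for i
    using that
  proof (induction i)
    case 0
    then show ?case
      using subgroup[of 0] fin by (simp add: card_mono subgroup.subset)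
  next
    case (Suc i)
    then have ni: "\<not> maps_into_powers p (P ^ i)"
      using maps_into_powers_mult_left[of p "P ^ i" P] by auto
    then have "card (W (Suc i)) < card (W i)"
      using stable[of i] anti[of i] finW[of i] by (intro psubset_card_mono) auto
    moreover obtain a b where "card (W (Suc i)) = p ^ a" "card (W i) = p ^ b"
      using cardW by meson
    \<comment> \<open>Distinct powers of \<open>p\<close> differ by a factor of at least
      \<open>p\<close>.\<close>
    ultimately have "card (W (Suc i)) * p \<le> card (W i)"
      using prime_gt_1_nat[OF p] by (metis power_Suc2 power_increasing power_less_imp_less_exp Suc_leI less_imp_le)
    then have "card (W (Suc i)) * p ^ Suc i \<le> card (W i) * p ^ i"
      by simp
    then show ?case
      using Suc.IH[OF ni] by linarith
  qed
  assume n: "\<not> maps_into_powers p (P ^ r)"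
  \<comment> \<open>This strict inclusion adds a strict inequality to the \<open>r\<close> shrinking
    steps, contradicting the bound on the index of the \<open>p\<close>-th powers.\<close>
  then have "(\<lambda>y. y [^] p) ` carrier G \<subset> W r"
    using powers W_iff by blast
  then have "card ((\<lambda>y. y [^] p) ` carrier G) < card (W r)"
    using finW psubset_card_mono by blast
  then have "p ^ r * card ((\<lambda>y. y [^] p) ` carrier G) < card (W r) * p ^ r"
    using prime_gt_0_nat[OF p] by simp
  then show False
    using shrink[OF n] r by linarith
qed

section \<open>Powers in the holomorph\<close>

text \<open>The restriction is there because elements of \<open>AutoGroup\<close> are extensional,
  which \<open>\<alpha> ^^ n\<close> need not be: for \<open>n = 0\<close> it is the identity on the
  whole type.\<close>

lemma holomorph_pow:
  assumes "\<alpha> \<in> auto G" "x \<in> carrier G"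
  shows "(x, \<alpha>) [^]\<^bsub>holomorph G\<^esub> n = (act (\<Sum>i<n. [:0, 1:] ^ i) x, \<lambda>y\<in>carrier G. (\<alpha> ^^ n) y)"
proof (induction n)
  case 0
  then show ?case
    by (simp add: nat_pow_def holomorph_def semidirect_product_def AutoGroup_def BijGroup_def
        restrict_def)
next
  case (Suc n)
  define \<beta> where "\<beta> = (\<lambda>y\<in>carrier G. (\<alpha> ^^ n) y)"
  have "bij_betw (\<alpha> ^^ n) (carrier G) (carrier G)"
    using assms(1) by (intro bij_betw_funpow) (simp add: auto_def Bij_def)
  then have Bij: "\<beta> \<in> Bij (carrier G)" "\<alpha> \<in> Bij (carrier G)"
    using assms(1) by (auto simp: auto_def Bij_def \<beta>_def)
  have "(x, \<alpha>) [^]\<^bsub>holomorph G\<^esub> Suc n = (x, \<alpha>) [^]\<^bsub>holomorph G\<^esub> n \<otimes>\<^bsub>holomorph G\<^esub> (x, \<alpha>)"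
    by (simp add: nat_pow_def)
  also have "\<dots> = (act (\<Sum>i<n. [:0, 1:] ^ i) x \<otimes> \<beta> x, compose (carrier G) \<beta> \<alpha>)"
    unfolding Suc \<beta>_def[symmetric]
    using Bij by (simp add: holomorph_def semidirect_product_def AutoGroup_def BijGroup_def)
  also have "\<beta> x = act ([:0, 1:] ^ n) x"
    using assms(2) by (simp add: \<beta>_def act_monom)
  also have "compose (carrier G) \<beta> \<alpha> = (\<lambda>y\<in>carrier G. (\<alpha> ^^ Suc n) y)"
    by (auto simp: \<beta>_def compose_def funpow_swap1 fun_eq_iff)
  finally show ?case
    using assms(2) by (simp only: act_add sum.lessThan_Suc)
qed

end

section \<open>Counting p-th powers in a group of given rank\<close>

lemma nat_pow_product_group:
  assumes "\<And>i. i \<in> I \<Longrightarrow> group (G i)" "x \<in> carrier (product_group I G)"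
  shows "x [^]\<^bsub>product_group I G\<^esub> (n :: nat) = (\<lambda>i\<in>I. x i [^]\<^bsub>G i\<^esub> n)"
  by (induction n) (auto simp: nat_pow_def fun_eq_iff)

text \<open>For the inequality, divide each coordinate by \<open>p\<close> with remainder: an
  element is a \<open>p\<close>-th power plus a vector of remainders, and there are
  \<open>p ^ r\<close> such vectors.\<close>

lemma card_product_cyclic_p_groups:
  fixes e :: "nat \<Rightarrow> nat" and p r :: nat
  assumes "0 < p"
  defines "P \<equiv> product_group {..<r} (\<lambda>i. integer_mod_group (p ^ e i))"
  shows "card (carrier P) = p ^ (\<Sum>i<r. e i)"
    and "card (carrier P) \<le> p ^ r * card ((\<lambda>y. y [^]\<^bsub>P\<^esub> p) ` carrier P)"
proof -
  have C: "carrier P = (\<Pi>\<^sub>E i\<in>{..<r}. {0..<int p ^ e i})"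
    using assms(1) by (auto simp: P_def carrier_integer_mod_group intro!: PiE_cong)
  show "card (carrier P) = p ^ (\<Sum>i<r. e i)"
    by (simp add: C card_PiE power_sum nat_power_eq)
  let ?R = "\<Pi>\<^sub>E i\<in>{..<r}. {0..<int p}" and ?Q = "(\<lambda>y. y [^]\<^bsub>P\<^esub> p) ` carrier P"
  have fin: "finite ?Q" "finite ?R"
    by (auto simp: C intro!: finite_PiE)
  have "carrier P \<subseteq> (\<lambda>(s, u). \<lambda>i\<in>{..<r}. s i + u i) ` (?R \<times> ?Q)"
  proof
    fix x assume x: "x \<in> carrier P"
    define y where "y = (\<lambda>i\<in>{..<r}. x i div int p)"
    have lt: "0 \<le> x i" "x i < int p ^ e i" if "i < r" for i
      using x that by (auto simp: C PiE_iff)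
    have y: "y \<in> carrier P"
    proof -
      have "x i div int p < int p ^ e i" if "i < r" for i
        using lt[OF that] assms(1) zdiv_mono2[of "x i" 1 "int p"] by simp
      then show ?thesis
        using lt assms(1) by (auto simp: C y_def pos_imp_zdiv_nonneg_iff)
    qed
    \<comment> \<open>The multiple of \<open>p\<close> is at most \<open>x i\<close>, so no
      reduction takes place and the \<open>p\<close>-th power in the group is the integer
      multiple.\<close>
    have "int p * (x i div int p) mod int p ^ e i = int p * (x i div int p)" if "i < r" for i
    proof -
      have "int p * (x i div int p) \<le> x i"
        using assms(1) mult_div_mod_eq[of "int p" "x i"] pos_mod_sign[of "int p" "x i"] by linarith
      then show ?thesis
        using lt[OF that] assms(1) by (simp add: pos_imp_zdiv_nonneg_iff)
    qed
    then have "(y [^]\<^bsub>P\<^esub> p) i = int p * (x i div int p)" if "i < r" for i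
      using y that unfolding P_def
      by (subst nat_pow_product_group) (auto simp: y_def)
    then have "x = (\<lambda>i\<in>{..<r}. (\<lambda>i\<in>{..<r}. x i mod int p) i + (y [^]\<^bsub>P\<^esub> p) i)"
      using x by (auto simp: fun_eq_iff C PiE_iff extensional_def)
    moreover have "(\<lambda>i\<in>{..<r}. x i mod int p) \<in> ?R"
      using assms(1) by auto
    ultimately show "x \<in> (\<lambda>(s, u). \<lambda>i\<in>{..<r}. s i + u i) ` (?R \<times> ?Q)"
      using y by (intro image_eqI[of _ _ "(\<lambda>i\<in>{..<r}. x i mod int p, y [^]\<^bsub>P\<^esub> p)"]) auto
  qed
  then have "card (carrier P) \<le> card (?R \<times> ?Q)"
    by (rule surj_card_le[rotated]) (intro finite_cartesian_product fin)
  then show "card (carrier P) \<le> p ^ r * card ?Q"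
    by (simp add: card_cartesian_product card_PiE)
qed

text \<open>An isomorphism preserves the order and carries \<open>p\<close>-th powers onto
  \<open>p\<close>-th powers. These are the two counting hypotheses of
  \<open>maps_into_powers_power\<close>.\<close>

lemma has_rank_card:
  assumes "group N" "has_rank p N r" "0 < p"
  shows "\<exists>s. card (carrier N) = p ^ s"
    and "card (carrier N) \<le> p ^ r * card ((\<lambda>y. y [^]\<^bsub>N\<^esub> p) ` carrier N)"
proof -
  obtain e where "N \<cong> product_group {..<r} (\<lambda>i. integer_mod_group (p ^ e i))"
    using assms(2) by (auto simp: has_rank_def)
  moreover define P where "P = product_group {..<r} (\<lambda>i. integer_mod_group (p ^ e i))"
  ultimately obtain h where h: "h \<in> hom N P" "bij_betw h (carrier N) (carrier P)"
    by (auto simp: is_iso_def iso_def)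
  have P: "group P"
    by (simp add: P_def)
  note card = card_product_cyclic_p_groups[OF assms(3), of r e, folded P_def]
  have eq: "card (carrier N) = card (carrier P)"
    using h(2) by (rule bij_betw_same_card)
  show "\<exists>s. card (carrier N) = p ^ s"
    using eq card(1) by metis
  have "h ` (\<lambda>y. y [^]\<^bsub>N\<^esub> p) ` carrier N = (\<lambda>y. h y [^]\<^bsub>P\<^esub> p) ` carrier N"
    unfolding image_image by (rule image_cong) (simp_all add: hom_nat_pow[OF h(1) _ assms(1) P])
  also have "\<dots> = (\<lambda>y. y [^]\<^bsub>P\<^esub> p) ` carrier P"
    unfolding bij_betw_imp_surj_on[OF h(2), symmetric] image_image ..
  finally have "card ((\<lambda>y. y [^]\<^bsub>P\<^esub> p) ` carrier P) = card (h ` (\<lambda>y. y [^]\<^bsub>N\<^esub> p) ` carrier N)"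
    by simp
  also have "\<dots> = card ((\<lambda>y. y [^]\<^bsub>N\<^esub> p) ` carrier N)"
    by (rule card_image, rule inj_on_subset[OF bij_betw_imp_inj_on[OF h(2)]])
      (auto simp: monoid.nat_pow_closed[OF group.is_monoid[OF assms(1)]])
  finally show "card (carrier N) \<le> p ^ r * card ((\<lambda>y. y [^]\<^bsub>N\<^esub> p) ` carrier N)"
    using eq card(2) by simp
qed

section \<open>The exponent and the final bound\<close>

text \<open>The group order is an admissible exponent, so the \<open>LEAST\<close> is
  attained.\<close>

lemma pow_group_exponent:
  assumes "group G" "finite (carrier G)" "x \<in> carrier G"
  shows "x [^]\<^bsub>G\<^esub> group_exponent G = \<one>\<^bsub>G\<^esub>"
proof -
  interpret group G by fact
  have "0 < Coset.order G \<and> (\<forall>x\<in>carrier G. x [^]\<^bsub>G\<^esub> Coset.order G = \<one>\<^bsub>G\<^esub>)"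
    using assms(2) by (simp add: pow_order_eq_1 order_gt_0_iff_finite)
  then show ?thesis
    unfolding group_exponent_def
    using LeastI[of "\<lambda>n. 0 < n \<and> (\<forall>x\<in>carrier G. x [^]\<^bsub>G\<^esub> n = \<one>\<^bsub>G\<^esub>)"] assms(3) by blast
qed

theorem lemma2p6:
  fixes N :: "('a, 'b) monoid_scheme" and p r d k :: nat
  assumes "Factorial_Ring.prime p"
    and "comm_group N"
    and "finite (carrier N)"
    and "is_p_group p N"
    and "\<not> trivial_group N"
    and "has_rank p N r"
    and "group_exponent N = p ^ d"
    and "\<exists>g\<in>carrier (holomorph N). group.ord (holomorph N) g = p ^ k"
  shows "int k < \<lceil>log (real p) (real r + 1)\<rceil> + int d"
proof -
  interpret comm_group N by fact
  interpret H: group "holomorph N"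
    by (rule group_holomorph) (rule is_group)
  obtain x \<alpha> where g: "(x, \<alpha>) \<in> carrier (holomorph N)" "H.ord (x, \<alpha>) = p ^ k"
    using assms(8) by auto
  then have x: "x \<in> carrier N" and \<alpha>: "\<alpha> \<in> auto N"
    by (auto simp: holomorph_def semidirect_product_def AutoGroup_def)
  interpret endo_group N \<alpha>
    using \<alpha> by unfold_locales (simp add: auto_def)
  note p = assms(1) and p1 = prime_gt_1_nat[OF assms(1)] and p0 = prime_gt_0_nat[OF assms(1)]
  have exp: "y [^]\<^bsub>N\<^esub> (p ^ d) = \<one>\<^bsub>N\<^esub>" if "y \<in> carrier N" for y
    using pow_group_exponent[OF is_group assms(3) that] assms(7) by simp
  \<comment> \<open>Nontriviality gives \<open>d = Suc j\<close>, so that the exponent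
    \<open>m + d - 1\<close> can be written \<open>m + j\<close>.\<close>
  have "d \<noteq> 0"
  proof
    assume "d = 0"
    then have "carrier N = {\<one>\<^bsub>N\<^esub>}"
      using exp by auto
    then show False
      using assms(5) is_group by (simp add: trivial_group_def)
  qed
  then obtain j where j: "d = Suc j"
    by (metis not0_implies_Suc)
  \<comment> \<open>This is the least \<open>m\<close> with \<open>r < p ^ m\<close>; the logarithm
    is nonnegative, so \<open>nat\<close> loses nothing.\<close>
  define m where "m = nat \<lceil>log (real p) (real r + 1)\<rceil>"
  have m: "int m = \<lceil>log (real p) (real r + 1)\<rceil>"
  proof -
    have "0 \<le> log (real p) (real r + 1)"
      using p1 by simp
    then show ?thesis
      unfolding m_def by linarith
  qed
  have "real r + 1 \<le> real p powr real m"
    using less_log_iff[of "real p" "real r + 1" "real m"] p1 m by linarith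
  then have "real (r + 1) \<le> real (p ^ m)"
    using p0 by (simp add: powr_realpow)
  then have rm: "r < p ^ m"
    unfolding of_nat_le_iff by simp
  have one_pow: "(x, \<alpha>) [^]\<^bsub>holomorph N\<^esub> (p ^ k) = \<one>\<^bsub>holomorph N\<^esub>"
    using H.pow_ord_eq_1[OF g(1)] g(2) by simp
  \<comment> \<open>Compare the second components in \<open>one_pow\<close>.\<close>
  have "(\<alpha> ^^ p ^ k) y = y" if y: "y \<in> carrier N" for y
  proof -
    have "(\<lambda>y\<in>carrier N. (\<alpha> ^^ p ^ k) y) = (\<lambda>y\<in>carrier N. y)"
      using one_pow unfolding holomorph_pow[OF \<alpha> x]
      by (simp add: holomorph_def semidirect_product_def AutoGroup_def BijGroup_def)
    then show ?thesis
      using y by (metis restrict_apply')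
  qed
  then have "maps_into_powers p (([:0, 1:] - 1) ^ p ^ k)"
    by (rule maps_into_powers_minus_one_power[OF p])
  then have "maps_into_powers p (([:0, 1:] - 1) ^ r)"
    using maps_into_powers_power[OF p assms(3)] has_rank_card[OF is_group assms(6) p0] by blast
  then have S: "maps_into_powers (p ^ d) (\<Sum>i<p ^ (m + j). [:0, 1:] ^ i)"
    unfolding j by (rule maps_into_powers_geometric_sum[OF p _ rm])
  have kill: "act (\<Sum>i<p ^ (m + j). [:0, 1:] ^ i) y = \<one>\<^bsub>N\<^esub>" if "y \<in> carrier N" for y
    using maps_into_powersE[OF S that] exp by metis
  have "(\<alpha> ^^ p ^ (m + j)) y = y" if y: "y \<in> carrier N" for y
  proof -
    have "[:0, 1:] ^ p ^ (m + j) = ([:0, 1:] - 1) * (\<Sum>i<p ^ (m + j). [:0, 1:] ^ i) + (1 :: int poly)"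
      by (simp flip: power_diff_1_eq)
    then have "act ([:0, 1:] ^ p ^ (m + j)) y = y"
      using y by (simp only: act_add act_mult kill act_one_arg act_1 l_one)
    then show ?thesis
      using y by (simp add: act_monom)
  qed
  then have "(\<lambda>y\<in>carrier N. (\<alpha> ^^ p ^ (m + j)) y) = (\<lambda>y\<in>carrier N. y)"
    by (intro restrict_ext)
  then have "(x, \<alpha>) [^]\<^bsub>holomorph N\<^esub> (p ^ (m + j)) = \<one>\<^bsub>holomorph N\<^esub>"
    unfolding holomorph_pow[OF \<alpha> x] kill[OF x]
    by (simp add: holomorph_def semidirect_product_def AutoGroup_def BijGroup_def)
  then have "p ^ k dvd p ^ (m + j)"
    using H.pow_eq_id[OF g(1)] g(2) by simp
  then have "k \<le> m + j"
    using p1 by (rule power_dvd_imp_le)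
  \<comment> \<open>The bound \<open>k \<le> m + j\<close> is strict against \<open>m + d\<close>
    because \<open>d = Suc j\<close>.\<close>
  then show ?thesis
    unfolding m[symmetric] j by linarith
qed

end
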